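(* Let $n>2$ and consider all connected bipartite graphs of order $n$. If $n$ is odd, then $K_{\lfloor n/2\rfloor,\lceil n/2\rceil}-e$ has the second-largest $\prod_1$-value and the second-largest $\prod_2$-value. If $n$ is even, then $K_{\lfloor n/2\rfloor,\lceil n/2\rceil}-e$ has the second-largest $\prod_1$-value, and $K_{\lfloor (n-2)/2\rfloor,\lceil (n+2)/2\rceil}$ has the second-largest $\prod_2$-value.
   Context: All graphs are finite, simple, undirected and connected; $d(u)$ denotes the degree of a vertex $u$. The first and second multiplicative Zagreb indices of a graph $G$ are $\prod_1(G)=\prod_{u\in V(G)}d(u)^2$ and $\prod_2(G)=\prod_{uv\in E(G)}d(u)d(v)=\prod_{u\in V(G)}d(u)^{d(u)}$. $K_{s,t}$ is the complete bipartite graph with parts of sizes $s$ and $t$, and $K_{s,t}-e$ is the graph obtained from it by deleting one edge. "Second-largest" means the largest of the values attained by graphs in the class that are strictly smaller than the maximum value attained in the class.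
   Formalization: The case n = 3 is excluded: the only connected bipartite graph of order 3 is K_{1,2}, so no second-largest value exists, and K_{1,2}−e is disconnected; all other n > 2 are covered. *)

theory Defs
  imports Complex_Main "Graph_Theory.Graph_Theory" "Graph_Theory.Kuratowski"
begin

text \<open>
  A simple undirected graph is a \<open>pair_graph\<close>: a finite loop-free symmetric set of arcs, in which
  an undirected edge \<open>uv\<close> is the pair of arcs \<open>(u, v)\<close>, \<open>(v, u)\<close>. Hence the degree of a vertex is
  its out-degree.
\<close>

abbreviation degree :: "'a pair_pre_digraph \<Rightarrow> 'a \<Rightarrow> nat" where
  "degree G u \<equiv> out_degree (with_proj G) u"

definition edges :: "'a pair_pre_digraph \<Rightarrow> 'a set set" where
  "edges G = (\<lambda>(u, v). {u, v}) ` parcs G"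

definition zagreb1 :: "'a pair_pre_digraph \<Rightarrow> nat" where
  "zagreb1 G = (\<Prod>u\<in>pverts G. degree G u ^ 2)"

text \<open>Each undirected edge contributes once; for an edge \<open>e = {u, v}\<close> the inner product is
  \<open>d(u) d(v)\<close>, because \<open>u \<noteq> v\<close>.\<close>

definition zagreb2 :: "'a pair_pre_digraph \<Rightarrow> nat" where
  "zagreb2 G = (\<Prod>e\<in>edges G. \<Prod>u\<in>e. degree G u)"

definition bipartite :: "'a pair_pre_digraph \<Rightarrow> bool" where
  "bipartite G \<longleftrightarrow> (\<exists>U V. pverts G = U \<union> V \<and> U \<inter> V = {} \<and> parcs G \<subseteq> U \<times> V \<union> V \<times> U)"

definition connected_bipartite_graphs :: "nat \<Rightarrow> 'a pair_pre_digraph set" where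
  "connected_bipartite_graphs n =
     {G. pair_graph G \<and> Digraph_Component.connected (with_proj G) \<and> bipartite G
       \<and> card (pverts G) = n}"

definition delete_edge :: "'a pair_pre_digraph \<Rightarrow> 'a \<Rightarrow> 'a \<Rightarrow> 'a pair_pre_digraph" where
  "delete_edge G u v = \<lparr> pverts = pverts G, parcs = parcs G - {(u, v), (v, u)} \<rparr>"

text \<open>Like \<open>complete_bipartite_digraph\<close>, this describes the graph up to isomorphism: \<open>G\<close> is some
  copy of \<open>K_{s,t}\<close> with some edge removed. For \<open>s = 1\<close> or \<open>t = 1\<close> it is disconnected. In particular \<open>K_{1,2} - e\<close>
  is not a connected graph, and the only connected graph of order 3 that is bipartite is \<open>K_{1,2}\<close>,
  so at order 3 neither index has a second-largest value.\<close>

definition complete_bipartite_minus_edge :: "nat \<Rightarrow> nat \<Rightarrow> 'a pair_pre_digraph \<Rightarrow> bool" where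
  "complete_bipartite_minus_edge s t G \<longleftrightarrow>
     (\<exists>K u v. complete_bipartite_digraph s t (with_proj K) \<and> (u, v) \<in> parcs K
       \<and> G = delete_edge K u v)"

text \<open>\<open>G\<close> is a member of the class \<open>C\<close> and attains the largest value of \<open>f\<close> among those strictly
  below the maximum \<open>f M\<close> over \<open>C\<close>.\<close>

definition has_second_largest :: "('g \<Rightarrow> nat) \<Rightarrow> 'g set \<Rightarrow> 'g \<Rightarrow> bool" where
  "has_second_largest f C G \<longleftrightarrow> G \<in> C \<and>
     (\<exists>M\<in>C. (\<forall>H\<in>C. f H \<le> f M) \<and> f G < f M \<and> (\<forall>H\<in>C. f H < f M \<longrightarrow> f H \<le> f G))"

end

(*
  Both indices have the form prod_u g(d(u)) with g increasing (g(d) = d^2 and g(d) = d^d), hence are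
  monotone under adding edges. A bipartite graph whose parts have the sizes s, t of the balanced
  partition is either K_{s,t} itself or contained in some K_{s,t} - e; every other bipartite graph
  is contained in an unbalanced K_{a,b}. So only numerical values have to be compared.
  For the second index the value of K_{a,b} is (ab)^(ab), and ab <= st - 1 (n even) or
  ab <= st - 2 (n odd) if the parts are unbalanced. The comparison with K_{s,t} - e then comes down
  to (p + 2)^p <= (p + 1)^2 p^p with p = s - 1 if n is odd, where e < 3 suffices, and to
  Bernoulli's inequality if n is even.
*)
theory Submission
  imports Defs
begin

section \<open>Degree products and concrete models of the extremal graphs\<close>

definition deg_prod :: "(nat \<Rightarrow> nat) \<Rightarrow> 'a pair_pre_digraph \<Rightarrow> nat" where
  "deg_prod g G = (\<Prod>u\<in>pverts G. g (degree G u))"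

definition bipartite_join :: "'a set \<Rightarrow> 'a set \<Rightarrow> 'a pair_pre_digraph" where
  "bipartite_join U V = \<lparr> pverts = U \<union> V, parcs = U \<times> V \<union> V \<times> U \<rparr>"

text \<open>Value on \<open>K_{s,t}\<close>: \<open>s\<close> vertices have degree \<open>t\<close>,
  and \<open>t\<close> vertices have degree \<open>s\<close>.\<close>

definition deg_prod_complete :: "(nat \<Rightarrow> nat) \<Rightarrow> nat \<Rightarrow> nat \<Rightarrow> nat" where
  "deg_prod_complete g s t = g t ^ s * g s ^ t"

text \<open>Value on \<open>K_{s,t} - e\<close>: exactly one vertex on each side has lost a
  neighbour.\<close>

definition deg_prod_minus :: "(nat \<Rightarrow> nat) \<Rightarrow> nat \<Rightarrow> nat \<Rightarrow> nat" where
  "deg_prod_minus g s t = g t ^ (s - 1) * g (t - 1) * (g s ^ (t - 1) * g (s - 1))"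

lemma bipartite_join_simps [simp]:
  "pverts (bipartite_join U V) = U \<union> V"
  "parcs (bipartite_join U V) = U \<times> V \<union> V \<times> U"
  by (simp_all add: bipartite_join_def)

lemma delete_edge_simps [simp]:
  "pverts (delete_edge G u v) = pverts G"
  "parcs (delete_edge G u v) = parcs G - {(u, v), (v, u)}"
  by (simp_all add: delete_edge_def)

lemma delete_edge_commute: "delete_edge G u v = delete_edge G v u"
  by (simp add: delete_edge_def insert_commute)

lemma complete_bipartite_digraph_iff:
  "complete_bipartite_digraph s t (with_proj G) \<longleftrightarrow>
     (\<exists>U V. finite U \<and> finite V \<and> U \<inter> V = {} \<and> card U = s \<and> card V = t \<and> G = bipartite_join U V)"
  unfolding complete_bipartite_digraph_pair_def
proof safe
  fix U V
  assume "pverts G = U \<union> V" "parcs G = U \<times> V \<union> V \<times> U" "finite (pverts G)" "U \<inter> V = {}"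
  moreover from this have "G = bipartite_join U V"
    by (intro pair_pre_digraph.equality) simp_all
  ultimately show "\<exists>U' V'. finite U' \<and> finite V' \<and> U' \<inter> V' = {} \<and> card U' = card U \<and>
      card V' = card V \<and> G = bipartite_join U' V'"
    by auto
next
  fix U V :: "'a set"
  assume "finite U" "finite V" "U \<inter> V = {}"
  then show "finite (pverts (bipartite_join U V))"
    "\<exists>U' V'. pverts (bipartite_join U V) = U' \<union> V' \<and> U' \<inter> V' = {} \<and> card U' = card U \<and>
      card V' = card V \<and> parcs (bipartite_join U V) = U' \<times> V' \<union> V' \<times> U'"
    by auto
qed

lemma complete_bipartite_minus_edgeE:
  assumes "complete_bipartite_minus_edge s t G"
  obtains U V u v where "finite U" "finite V" "U \<inter> V = {}" "card U = s" "card V = t"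
    "u \<in> U" "v \<in> V" "G = delete_edge (bipartite_join U V) u v"
proof -
  obtain U V u v where "finite U" "finite V" "U \<inter> V = {}" "card U = s" "card V = t"
    and "(u, v) \<in> U \<times> V \<union> V \<times> U" and G: "G = delete_edge (bipartite_join U V) u v"
    using assms unfolding complete_bipartite_minus_edge_def complete_bipartite_digraph_iff by auto
  \<comment> \<open>The deleted arc may start in \<open>V\<close>; deletion ignores the order of the
    two endpoints, so they can be swapped.\<close>
  with that[of U V u v] that[of U V v u] show thesis
    unfolding G by (auto simp: delete_edge_commute)
qed

subsection \<open>Products over the degrees\<close>

lemma degree_eq_card_Image: "degree G u = card (parcs G `` {u})"
proof -
  have "out_arcs (with_proj G) u = Pair u ` (parcs G `` {u})"
    by (auto simp: out_arcs_def)
  then show ?thesis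
    by (simp add: out_degree_def card_image inj_on_def)
qed

lemma degree_bipartite_join:
  assumes "U \<inter> V = {}"
  shows "u \<in> U \<Longrightarrow> degree (bipartite_join U V) u = card V"
    and "v \<in> V \<Longrightarrow> degree (bipartite_join U V) v = card U"
proof -
  have "u \<in> U \<Longrightarrow> (U \<times> V \<union> V \<times> U) `` {u} = V" "v \<in> V \<Longrightarrow> (U \<times> V \<union> V \<times> U) `` {v} = U"
    using assms by auto
  then show "u \<in> U \<Longrightarrow> degree (bipartite_join U V) u = card V"
    "v \<in> V \<Longrightarrow> degree (bipartite_join U V) v = card U"
    by (simp_all add: degree_eq_card_Image)
qed

lemma degree_delete_edge:
  assumes "(u, v) \<in> parcs G" "(v, u) \<in> parcs G" "u \<noteq> v"
  shows "degree (delete_edge G u v) x = (if x \<in> {u, v} then degree G x - 1 else degree G x)"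
proof -
  have "(parcs G - {(u, v), (v, u)}) `` {u} = parcs G `` {u} - {v}"
    "(parcs G - {(u, v), (v, u)}) `` {v} = parcs G `` {v} - {u}"
    "x \<notin> {u, v} \<Longrightarrow> (parcs G - {(u, v), (v, u)}) `` {x} = parcs G `` {x}"
    using assms by auto
  then show ?thesis
    using assms by (auto simp: degree_eq_card_Image card_Diff_singleton)
qed

lemma deg_prod_bipartite_join:
  assumes "finite U" "finite V" "U \<inter> V = {}"
  shows "deg_prod g (bipartite_join U V) = deg_prod_complete g (card U) (card V)"
  using assms
  by (simp add: deg_prod_def deg_prod_complete_def prod.union_disjoint degree_bipartite_join)

lemma deg_prod_delete_edge:
  assumes "finite U" "finite V" "U \<inter> V = {}" "u \<in> U" "v \<in> V"
  shows "deg_prod g (delete_edge (bipartite_join U V) u v) = deg_prod_minus g (card U) (card V)"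
proof -
  let ?d = "degree (delete_edge (bipartite_join U V) u v)"
  have arcs: "(u, v) \<in> parcs (bipartite_join U V)" "(v, u) \<in> parcs (bipartite_join U V)" "u \<noteq> v"
    using assms by auto
  have d: "?d u = card V - 1" "?d v = card U - 1"
    "\<And>x. x \<in> U - {u} \<Longrightarrow> ?d x = card V" "\<And>x. x \<in> V - {v} \<Longrightarrow> ?d x = card U"
    using assms by (auto simp: degree_delete_edge[OF arcs] degree_bipartite_join)
  have "(\<Prod>x\<in>U. g (?d x)) = g (card V - 1) * g (card V) ^ (card U - 1)"
    using assms by (subst prod.remove[of _ u]) (simp_all add: d card_Diff_singleton del: Diff_iff)
  moreover have "(\<Prod>x\<in>V. g (?d x)) = g (card U - 1) * g (card U) ^ (card V - 1)"
    using assms by (subst prod.remove[of _ v]) (simp_all add: d card_Diff_singleton del: Diff_iff)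
  ultimately show ?thesis
    using assms by (simp add: deg_prod_def deg_prod_minus_def prod.union_disjoint)
qed

lemma deg_prod_mono:
  assumes "mono g" "pverts G = pverts H" "parcs G \<subseteq> parcs H" "finite (parcs H)"
  shows "deg_prod g G \<le> deg_prod g H"
proof -
  have "degree G u \<le> degree H u" for u
    unfolding degree_eq_card_Image
    using assms by (intro card_mono finite_Image Image_mono) auto
  then show ?thesis
    unfolding deg_prod_def \<open>pverts G = _\<close> using \<open>mono g\<close> by (intro prod_mono) (auto dest: monoD)
qed

section \<open>The two Zagreb indices as degree products\<close>

lemma zagreb1_eq_deg_prod: "zagreb1 = deg_prod (\<lambda>d. d ^ 2)"
  by (simp add: fun_eq_iff zagreb1_def deg_prod_def)

text \<open>Exchange the product over edges with the product over endpoints: \<open>u\<close>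
  contributes the factor \<open>degree G u\<close> once for every edge through it, hence
  \<open>degree G u\<close> times.\<close>

lemma zagreb2_eq_deg_prod:
  assumes "pair_graph G"
  shows "zagreb2 G = deg_prod (\<lambda>d. d ^ d) G"
proof -
  interpret pair_graph G by fact
  have fin: "finite (edges G)"
    by (simp add: edges_def pair_finite_arcs)
  have sub: "e \<subseteq> pverts G" if "e \<in> edges G" for e
    using that by (auto simp: edges_def dest: in_arcsD1 in_arcsD2)
  have card: "card {e \<in> edges G. u \<in> e} = degree G u" for u
  proof -
    have "{e \<in> edges G. u \<in> e} = (\<lambda>v. {u, v}) ` (parcs G `` {u})"
    proof
      show "{e \<in> edges G. u \<in> e} \<subseteq> (\<lambda>v. {u, v}) ` (parcs G `` {u})"
        by (auto simp: edges_def insert_commute intro: arcs_symmetric)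
      show "(\<lambda>v. {u, v}) ` (parcs G `` {u}) \<subseteq> {e \<in> edges G. u \<in> e}"
        by (force simp: edges_def)
    qed
    then show ?thesis
      by (simp add: degree_eq_card_Image card_image inj_on_def doubleton_eq_iff)
  qed
  have "zagreb2 G = (\<Prod>e\<in>edges G. \<Prod>u\<in>{u. u \<in> pverts G \<and> u \<in> e}. degree G u)"
    unfolding zagreb2_def using sub by (intro prod.cong refl) auto
  also have "\<dots> = (\<Prod>u\<in>pverts G. \<Prod>e\<in>{e. e \<in> edges G \<and> u \<in> e}. degree G u)"
    using fin pair_finite_verts by (rule prod.swap_restrict)
  finally show ?thesis
    by (simp add: card deg_prod_def)
qed

subsection \<open>Graphs in the class\<close>

lemma pair_graph_bipartite:
  assumes "finite U" "finite V" "U \<inter> V = {}" "pverts G = U \<union> V"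
    "parcs G \<subseteq> U \<times> V \<union> V \<times> U" "sym (parcs G)"
  shows "pair_graph G"
proof
  show "finite (parcs G)"
    using assms(5) by (rule finite_subset) (use assms in auto)
qed (use assms in \<open>auto simp: symmetric_def\<close>)

text \<open>Every vertex reaches \<open>v\<close>: those of \<open>U\<close> directly, those of
  \<open>V\<close> by way of \<open>u\<close>. One vertex on each side that is joined to the whole
  opposite side thus suffices, a condition that both \<open>K_{s,t}\<close> and
  \<open>K_{s,t} - e\<close> can meet.\<close>

lemma connected_bipartite_hubs:
  assumes "pverts G = U \<union> V" "u \<in> U" "v \<in> V" "U \<times> {v} \<subseteq> parcs G" "V \<times> {u} \<subseteq> parcs G"
  shows "Digraph_Component.connected (with_proj G)"
proof -
  let ?R = "rtrancl_on (pverts G) ((parcs G)\<^sup>s)"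
  \<comment> \<open>Connectedness is reachability in the symmetric closure, so a single arc links
    its ends in both directions.\<close>
  have step: "(x, y) \<in> ?R \<and> (y, x) \<in> ?R" if "(x, y) \<in> parcs G" "x \<in> pverts G" "y \<in> pverts G" for x y
  proof -
    have "(x, y) \<in> (parcs G)\<^sup>s" "(y, x) \<in> (parcs G)\<^sup>s"
      using that(1) by (auto simp: symcl_def image_iff intro: bexI[of _ "(x, y)"])
    with that show ?thesis
      by (meson rtrancl_on_into_rtrancl_on rtrancl_on_refl)
  qed
  have hub: "(x, v) \<in> ?R \<and> (v, x) \<in> ?R" if x: "x \<in> pverts G" for x
  proof -
    have uv: "(u, v) \<in> ?R \<and> (v, u) \<in> ?R"
      using assms by (intro step) auto
    consider "x \<in> U" | "x \<in> V" using x assms by auto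
    then show ?thesis
    proof cases
      case 1
      then show ?thesis using assms by (intro step) auto
    next
      case 2
      then have "(x, u) \<in> ?R \<and> (u, x) \<in> ?R" using assms by (intro step) auto
      with uv show ?thesis by (meson rtrancl_on_trans)
    qed
  qed
  then have "(x, y) \<in> ?R" if "x \<in> pverts G" "y \<in> pverts G" for x y
    using that by (meson rtrancl_on_trans)
  moreover have "pverts G \<noteq> {}"
    using assms by auto
  ultimately show ?thesis
    by (simp add: connected_conv)
qed

lemma bipartite_join_in_class:
  assumes "finite U" "finite V" "U \<inter> V = {}" "U \<noteq> {}" "V \<noteq> {}"
  shows "bipartite_join U V \<in> connected_bipartite_graphs (card U + card V)"
proof -
  obtain u v where "u \<in> U" "v \<in> V" using assms by blast
  then have "Digraph_Component.connected (with_proj (bipartite_join U V))"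
    by (intro connected_bipartite_hubs[of _ U V u v]) auto
  moreover have "pair_graph (bipartite_join U V)"
    using assms by (intro pair_graph_bipartite[of U V]) (auto simp: sym_def)
  moreover have "bipartite (bipartite_join U V)"
    using assms unfolding bipartite_def by (intro exI[of _ U] exI[of _ V]) auto
  ultimately show ?thesis
    using assms by (auto simp: connected_bipartite_graphs_def card_Un_disjoint)
qed

lemma delete_edge_in_class:
  assumes "finite U" "finite V" "U \<inter> V = {}" "2 \<le> card U" "2 \<le> card V" "u \<in> U" "v \<in> V"
  shows "delete_edge (bipartite_join U V) u v \<in> connected_bipartite_graphs (card U + card V)"
proof -
  let ?G = "delete_edge (bipartite_join U V) u v"
  \<comment> \<open>With at least two vertices on each side, there are vertices untouched by the
    deletion; they keep all their edges and act as hubs.\<close>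
  have "\<not> U \<subseteq> {u}" "\<not> V \<subseteq> {v}"
    using assms card_mono[of "{u}" U] card_mono[of "{v}" V] by auto
  then obtain u' v' where "u' \<in> U" "u' \<noteq> u" "v' \<in> V" "v' \<noteq> v" by blast
  then have "Digraph_Component.connected (with_proj ?G)"
    using assms by (intro connected_bipartite_hubs[of _ U V u' v']) auto
  moreover have "pair_graph ?G"
    using assms by (intro pair_graph_bipartite[of U V]) (auto simp: sym_def)
  moreover have "bipartite ?G"
    using assms unfolding bipartite_def by (intro exI[of _ U] exI[of _ V]) auto
  ultimately show ?thesis
    using assms by (auto simp: connected_bipartite_graphs_def card_Un_disjoint)
qed

section \<open>Reduction to numerical inequalities\<close>

lemma deg_prod_cases:
  assumes H: "H \<in> connected_bipartite_graphs (s + t)" and "mono g" "s \<le> t" "t \<le> s + 1"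
  obtains "deg_prod g H = deg_prod_complete g s t"
  | "deg_prod g H \<le> deg_prod_minus g s t"
  | a b where "a < s" "a + b = s + t" "deg_prod g H \<le> deg_prod_complete g a b"
proof -
  obtain U V where UV: "pverts H = U \<union> V" "U \<inter> V = {}" "parcs H \<subseteq> U \<times> V \<union> V \<times> U"
    and le: "card U \<le> card V"
  proof -
    obtain U V where *: "pverts H = U \<union> V" "U \<inter> V = {}" "parcs H \<subseteq> U \<times> V \<union> V \<times> U"
      using H by (auto simp: connected_bipartite_graphs_def bipartite_def)
    then have "pverts H = V \<union> U" "V \<inter> U = {}" "parcs H \<subseteq> V \<times> U \<union> U \<times> V" by auto
    with * that show thesis by (meson nle_le)
  qed
  interpret pair_graph H using H by (simp add: connected_bipartite_graphs_def)
  have fin: "finite U" "finite V"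
    using pair_finite_verts UV by auto
  have sum: "card U + card V = s + t"
    using H UV fin by (auto simp: connected_bipartite_graphs_def card_Un_disjoint)
  have le_join: "deg_prod g H \<le> deg_prod_complete g (card U) (card V)"
    using deg_prod_mono[OF \<open>mono g\<close>, of H "bipartite_join U V"] UV fin
    by (simp add: deg_prod_bipartite_join)
  \<comment> \<open>The smaller part has at most \<open>s\<close> vertices: otherwise both parts
    would have at least \<open>s + 1\<close>, but \<open>s + t\<close> is at most
    \<open>2 * s + 1\<close>.\<close>
  consider "card U < s" | "card U = s" "card V = t"
    using le sum assms by linarith
  then show thesis
  proof cases
    case 1
    with sum le_join that show thesis by blast
  next
    case 2
    show thesis
    proof (cases "U \<times> V \<subseteq> parcs H")
      case True
      then have "V \<times> U \<subseteq> parcs H" by (auto intro: arcs_symmetric)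
      with True UV have "H = bipartite_join U V"
        by (intro pair_pre_digraph.equality) auto
      with 2 fin UV that(1) show thesis by (simp add: deg_prod_bipartite_join)
    next
      case False
      then obtain u v where uv: "u \<in> U" "v \<in> V" "(u, v) \<notin> parcs H" by blast
      then have "(v, u) \<notin> parcs H" by (auto dest: arcs_symmetric)
      with uv UV have "parcs H \<subseteq> parcs (delete_edge (bipartite_join U V) u v)" by auto
      then have "deg_prod g H \<le> deg_prod g (delete_edge (bipartite_join U V) u v)"
        using UV fin by (intro deg_prod_mono \<open>mono g\<close>) auto
      with 2 fin UV uv that(2) show thesis by (simp add: deg_prod_delete_edge)
    qed
  qed
qed

text \<open>\<open>G\<close> is kept arbitrary because the runner-up is \<open>K_{s,t} - e\<close>
  in some cases and an unbalanced complete bipartite graph in another. What remains to check is that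
  \<open>G\<close> dominates both kinds of competitors.\<close>

lemma has_second_largest_deg_prod:
  fixes G :: "'a pair_pre_digraph"
  assumes "mono g" "s \<le> t" "t \<le> s + 1" "0 < s"
    and G: "G \<in> connected_bipartite_graphs (s + t)"
    and less: "deg_prod g G < deg_prod_complete g s t"
    and minus: "deg_prod_minus g s t \<le> deg_prod g G"
    and unbalanced: "\<And>a b. a < s \<Longrightarrow> a + b = s + t \<Longrightarrow> deg_prod_complete g a b \<le> deg_prod g G"
  shows "has_second_largest (deg_prod g) (connected_bipartite_graphs (s + t)) G"
proof -
  have "finite (pverts G)" "card (pverts G) = s + t"
    using G pair_fin_digraph.pair_finite_verts
    by (auto simp: connected_bipartite_graphs_def pair_graph_def pair_digraph_def)
  \<comment> \<open>The maximiser must live on the same vertex type, which may be finite. Splitting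
    the vertex set of \<open>G\<close> itself guarantees enough vertices for a copy of
    \<open>K_{s,t}\<close>.\<close>
  then obtain U where U: "U \<subseteq> pverts G" "card U = s"
    by (metis le_add1 obtain_subset_with_card_n)
  define V where "V = pverts G - U"
  define M where "M = bipartite_join U V"
  have fin: "finite U" "finite V" "U \<inter> V = {}"
    using U \<open>finite (pverts G)\<close> by (auto simp: V_def intro: finite_subset)
  have V: "card V = t"
    using U fin \<open>card (pverts G) = s + t\<close> by (simp add: V_def card_Diff_subset)
  have "M \<in> connected_bipartite_graphs (s + t)"
    using bipartite_join_in_class[OF fin] U V assms(2,4) by (force simp: M_def)
  moreover have M: "deg_prod g M = deg_prod_complete g s t"
    using fin U V by (simp add: M_def deg_prod_bipartite_join)
  moreover have H: "deg_prod g H = deg_prod_complete g s t \<or> deg_prod g H \<le> deg_prod g G"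
    if "H \<in> connected_bipartite_graphs (s + t)" for H :: "'a pair_pre_digraph"
    using that assms(1-3)
  proof (cases rule: deg_prod_cases)
    case 2
    with minus show ?thesis by linarith
  next
    case (3 a b)
    with unbalanced[of a b] show ?thesis by linarith
  qed auto
  moreover have "deg_prod g H \<le> deg_prod g M"
    if "H \<in> connected_bipartite_graphs (s + t)" for H :: "'a pair_pre_digraph"
    using H[OF that] M less by linarith
  moreover have "deg_prod g H \<le> deg_prod g G"
    if "H \<in> connected_bipartite_graphs (s + t)" "deg_prod g H < deg_prod g M"
    for H :: "'a pair_pre_digraph"
    using H[OF that(1)] that(2) M by linarith
  ultimately show ?thesis
    using G less unfolding has_second_largest_def by (intro conjI bexI[of _ M] ballI impI) simp_all
qed

subsection \<open>Comparison of the extremal values\<close>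

lemma self_power_mono:
  fixes x y :: nat
  assumes "x \<le> y"
  shows "x ^ x \<le> y ^ y"
proof (cases "y = 0")
  case False
  have "x ^ x \<le> y ^ x" using assms by (rule power_mono) simp
  also have "\<dots> \<le> y ^ y" using assms False by (intro power_increasing) auto
  finally show ?thesis .
qed (use assms in simp)

text \<open>Raise first the base, then the exponent; this is strict only for a positive exponent
  \<open>x\<close>, so \<open>x = 0\<close> is separate. The bound on \<open>y\<close> excludes
  \<open>0 ^ 0 = 1 ^ 1\<close>.\<close>

lemma self_power_strict_mono:
  fixes x y :: nat
  assumes "x < y" "2 \<le> y"
  shows "x ^ x < y ^ y"
proof (cases "x = 0")
  case True
  have "1 < y ^ y" using assms by (intro one_less_power) auto
  then show ?thesis using True by simp
next
  case False
  have "x ^ x < y ^ x" using assms False by (intro power_strict_mono) auto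
  also have "\<dots> \<le> y ^ y" using assms by (intro power_increasing) auto
  finally show ?thesis .
qed

text \<open>On each side one factor is replaced by a strictly smaller one, and the others are
  positive because \<open>g s\<close> and \<open>g t\<close> exceed natural numbers.\<close>

lemma deg_prod_minus_less_complete:
  assumes "g (s - 1) < g s" "g (t - 1) < g t" "0 < s" "0 < t"
  shows "deg_prod_minus g s t < deg_prod_complete g s t"
proof -
  have *: "g x ^ y = g x ^ (y - 1) * g x" if "0 < y" for x y
    using that by (metis Suc_diff_1 power_Suc2)
  have "g t ^ (s - 1) * g (t - 1) < g t ^ s"
    using assms by (simp add: *[of s])
  moreover have "g s ^ (t - 1) * g (s - 1) < g s ^ t"
    using assms by (simp add: *[of t])
  ultimately show ?thesis
    unfolding deg_prod_minus_def deg_prod_complete_def using assms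
    by (intro mult_strict_mono) auto
qed

text \<open>With \<open>s = a + c + 1\<close> and \<open>b = t + c + 1\<close> the difference
  \<open>s * t - a * b\<close> equals \<open>(c + 1) * (t - s + c + 1)\<close>, which is smallest at
  \<open>c = 0\<close>. The gap is 1 for \<open>t = s\<close> and 2 for
  \<open>t = s + 1\<close>.\<close>

lemma mult_le_of_sum_eq:
  fixes a b s t :: nat
  assumes "a < s" "s \<le> t" "a + b = s + t"
  shows "a * b + (t - s + 1) \<le> s * t"
proof -
  obtain c where s: "s = a + c + 1" using assms(1) less_imp_Suc_add by fastforce
  obtain e where t: "t = s + e" using assms(2) le_Suc_ex by blast
  have "b = a + 2 * c + 2 + e" using assms s t by simp
  then show ?thesis by (simp add: s t algebra_simps)
qed

section \<open>First index: unbalanced graphs against \<open>K_{s,t} - e\<close>\<close>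

lemma deg_prod_complete_id_le:
  assumes "a < s" "s \<le> t" "a + b = s + t"
  shows "deg_prod_complete (\<lambda>d. d) a b \<le> deg_prod_minus (\<lambda>d. d) s t"
proof -
  obtain c where s: "s = a + c + 1" using assms(1) less_imp_Suc_add by fastforce
  obtain e where t: "t = s + e" using assms(2) le_Suc_ex by blast
  have b: "b = a + (2 * c + (e + 2))" using assms s t by simp
  \<comment> \<open>With \<open>a \<le> b\<close>, the product \<open>a ^ b * b ^ a\<close> is \<open>(a * b) ^ a * a ^ (b - a)\<close>, and both \<open>a * b\<close>
    and \<open>a * a\<close> are at most \<open>s * t\<close>.\<close>
  have "deg_prod_complete (\<lambda>d. d) a b = (a * b) ^ a * ((a * a) ^ c * (a ^ e * (a * a)))"
    unfolding deg_prod_complete_def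
    by (subst (2) b) (simp add: power_add power_mult power_mult_distrib power2_eq_square)
  \<comment> \<open>The last two factors \<open>a\<close> are bounded by \<open>t - 1\<close> and
    \<open>s - 1\<close>, the lowered degrees in \<open>K_{s,t} - e\<close>. Since
    \<open>a + c = s - 1\<close> and \<open>s - 1 + e = t - 1\<close>, the remaining exponents fit
    as well.\<close>
  also have "\<dots> \<le> (s * t) ^ a * ((s * t) ^ c * (s ^ e * ((t - 1) * (s - 1))))"
  proof -
    have "a * b \<le> s * t" "a * a \<le> s * t" "a \<le> t - 1" "a \<le> s - 1" "a \<le> s"
      using mult_le_of_sum_eq[OF assms] assms by (auto intro: mult_mono)
    then have "(a * b) ^ a \<le> (s * t) ^ a" "(a * a) ^ c \<le> (s * t) ^ c" "a ^ e \<le> s ^ e"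
      "a * a \<le> (t - 1) * (s - 1)"
      by (simp_all add: power_mono mult_le_mono)
    then show ?thesis by (rule mult_le_mono[OF _ mult_le_mono[OF _ mult_le_mono]])
  qed
  also have "\<dots> = deg_prod_minus (\<lambda>d. d) s t"
  proof -
    have "t - 1 = a + c + e" "s - 1 = a + c" using s t by simp_all
    then show ?thesis
      by (simp add: deg_prod_minus_def power_add power_mult_distrib)
  qed
  finally show ?thesis .
qed

text \<open>The first index is a square, so its comparison reduces to that of plain degree
  products.\<close>

lemma deg_prod_complete_square: "deg_prod_complete (\<lambda>d. d ^ 2) s t = (deg_prod_complete (\<lambda>d. d) s t) ^ 2"
  by (simp add: deg_prod_complete_def power_mult_distrib flip: power_mult)
     (simp add: mult.commute)

lemma deg_prod_minus_square: "deg_prod_minus (\<lambda>d. d ^ 2) s t = (deg_prod_minus (\<lambda>d. d) s t) ^ 2"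
  by (simp add: deg_prod_minus_def power_mult_distrib flip: power_mult)
     (simp add: mult.commute)

section \<open>Second index: unbalanced graphs against \<open>K_{s,t} - e\<close>\<close>

lemma deg_prod_complete_self_power: "deg_prod_complete (\<lambda>d. d ^ d) s t = (s * t) ^ (s * t)"
  by (simp add: deg_prod_complete_def power_mult_distrib flip: power_mult)
     (simp add: mult.commute)

text \<open>For \<open>p \<ge> 2\<close>, dividing by \<open>p ^ p\<close> leaves
  \<open>(1 + 2 / p) ^ p \<le> exp 2 \<le> 9 \<le> (p + 1) ^ 2\<close>. The cases
  \<open>p = 0\<close> (with \<open>0 ^ 0 = 1\<close>) and \<open>p = 1\<close> are direct.\<close>

lemma add_two_power_le: "(p + 2) ^ p \<le> (p + 1) ^ 2 * p ^ p" for p :: nat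
proof -
  consider "p = 0" | "p = 1" | "2 \<le> p" by linarith
  then show ?thesis
  proof cases
    case 3
    have "(1 + 2 / real p) ^ p \<le> exp (2 / real p) ^ p"
      by (intro power_mono) (auto simp: exp_ge_add_one_self)
    also have "\<dots> = exp 1 ^ 2"
      using 3 by (simp flip: exp_of_nat_mult)
    also have "\<dots> \<le> 3 ^ 2"
      using exp_le by (intro power_mono) auto
    also have "\<dots> \<le> (real p + 1) ^ 2"
      using 3 by (intro power_mono) auto
    finally have "(1 + 2 / real p) ^ p * real p ^ p \<le> (real p + 1) ^ 2 * real p ^ p"
      by (intro mult_right_mono) auto
    also have "(1 + 2 / real p) ^ p * real p ^ p = (real p + 2) ^ p"
      using 3 by (simp add: distrib_right flip: power_mult_distrib)
    finally have "real ((p + 2) ^ p) \<le> real ((p + 1) ^ 2 * p ^ p)"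
      by (simp add: add.commute)
    then show ?thesis by linarith
  qed (simp_all add: power2_eq_square)
qed

text \<open>For \<open>s = p + 1\<close> and \<open>t = p + 2\<close> the gap of 2 gives
  \<open>a * b \<le> p * (p + 3) = s * t - 2\<close>. The base may then be raised to
  \<open>s * t\<close> while the exponent keeps the saving of 2.\<close>

lemma unbalanced_le_minus_odd:
  assumes "a < s" "a + b = s + (s + 1)"
  shows "deg_prod_complete (\<lambda>d. d ^ d) a b \<le> deg_prod_minus (\<lambda>d. d ^ d) s (s + 1)"
proof -
  obtain p where s: "s = p + 1" using assms(1) by (metis Suc_eq_plus1 less_imp_Suc_add)
  have ab: "a * b \<le> p * (p + 3)"
    using mult_le_of_sum_eq[of a s "s + 1" b] assms by (simp add: s algebra_simps)
  have "deg_prod_complete (\<lambda>d. d ^ d) a b \<le> (p * (p + 3)) ^ (p * (p + 3))"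
    unfolding deg_prod_complete_self_power using ab by (rule self_power_mono)
  also have "\<dots> \<le> ((p + 1) * (p + 2)) ^ (p * (p + 3))"
    by (intro power_mono) (auto simp: algebra_simps)
  \<comment> \<open>Compared with the value of \<open>K_{s,t} - e\<close>, the factor
    \<open>p + 2\<close> occurs \<open>p\<close> times too often, while
    \<open>(p + 1) ^ 2 * p ^ p\<close> is missing. \<open>add_two_power_le\<close> makes exactly
    this exchange.\<close>
  also have "\<dots> = (p + 1) ^ (p * (p + 3)) * (p + 2) ^ (p * (p + 2)) * (p + 2) ^ p"
    by (simp only: power_mult_distrib mult.assoc flip: power_add) (simp add: algebra_simps)
  also have "\<dots> \<le> (p + 1) ^ (p * (p + 3)) * (p + 2) ^ (p * (p + 2)) * ((p + 1) ^ 2 * p ^ p)"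
    by (intro mult_left_mono add_two_power_le) auto
  also have "\<dots> = (p + 2) ^ (p * (p + 2)) * ((p + 1) ^ (p * (p + 3)) * (p + 1) ^ 2) * p ^ p"
    by (simp only: ac_simps)
  also have "(p + 1) ^ (p * (p + 3)) * (p + 1) ^ 2 = (p + 1) ^ (p + 1) * (p + 1) ^ ((p + 1) * (p + 1))"
  proof -
    have "p * (p + 3) + 2 = (p + 1) + (p + 1) * (p + 1)" by (simp add: algebra_simps)
    then show ?thesis by (simp only: flip: power_add)
  qed
  also have "(p + 2) ^ (p * (p + 2)) * ((p + 1) ^ (p + 1) * (p + 1) ^ ((p + 1) * (p + 1))) * p ^ p
      = deg_prod_minus (\<lambda>d. d ^ d) s (s + 1)"
  proof -
    have "s - 1 = p" "s + 1 - 1 = p + 1" "s + 1 = p + 2" "s = p + 1" using s by simp_all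
    then show ?thesis
      unfolding deg_prod_minus_def by (simp only: ac_simps flip: power_mult)
  qed
  finally show ?thesis .
qed

text \<open>Both values are \<open>p\<close>-th powers. With \<open>q = p + 1\<close> and
  \<open>p * (p + 2) = q ^ 2 - 1\<close>, comparing the bases amounts to
  \<open>q ^ 2 \<le> (1 - 1 / q ^ 2) ^ p * (p + 2) ^ 2\<close>. Bernoulli bounds the power below by
  \<open>1 - p / q ^ 2\<close>, and the resulting polynomial inequality in \<open>p\<close> holds
  coefficient by coefficient.\<close>

lemma minus_le_unbalanced_even:
  "deg_prod_minus (\<lambda>d. d ^ d) (p + 1) (p + 1) \<le> deg_prod_complete (\<lambda>d. d ^ d) p (p + 2)"
proof -
  let ?q = "real p + 1"
  have "(?q ^ 2) ^ 2 \<le> (?q ^ 2 - real p) * (real p + 2) ^ 2"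
    by (simp add: power2_eq_square algebra_simps)
  also have "?q ^ 2 - real p = ?q ^ 2 * (1 + real p * (- 1 / ?q ^ 2))"
    by (simp add: field_simps)
  also have "\<dots> \<le> ?q ^ 2 * (1 + (- 1 / ?q ^ 2)) ^ p"
    by (intro mult_left_mono Bernoulli_inequality) (auto simp: field_simps)
  finally have "?q ^ 2 * ?q ^ 2 \<le> ?q ^ 2 * ((1 - 1 / ?q ^ 2) ^ p * (real p + 2) ^ 2)"
    by (simp add: power2_eq_square[of "?q ^ 2"] mult.assoc mult_right_mono)
  then have "?q ^ 2 \<le> (1 - 1 / ?q ^ 2) ^ p * (real p + 2) ^ 2"
    by (rule mult_left_le_imp_le) simp
  then have "(?q ^ 2) ^ p * ?q ^ 2 \<le> (?q ^ 2) ^ p * ((1 - 1 / ?q ^ 2) ^ p * (real p + 2) ^ 2)"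
    by (intro mult_left_mono) auto
  also have "\<dots> = (?q ^ 2 * (1 - 1 / ?q ^ 2)) ^ p * (real p + 2) ^ 2"
    by (simp only: power_mult_distrib mult.assoc)
  also have "?q ^ 2 * (1 - 1 / ?q ^ 2) = real p * (real p + 2)"
    by (simp add: right_diff_distrib) (simp add: power2_eq_square algebra_simps)
  finally have "real (((p + 1) ^ 2) ^ (p + 1)) \<le> real ((p * (p + 2)) ^ p * (p + 2) ^ 2)"
    by (simp only: of_nat_power of_nat_mult of_nat_add of_nat_1 of_nat_numeral power_add
        power_one_right)
  then have "((p + 1) ^ 2) ^ (p + 1) \<le> (p * (p + 2)) ^ p * (p + 2) ^ 2"
    by linarith
  \<comment> \<open>Restoring the factor \<open>p ^ 2\<close>, which comes from the two vertices of
    lowered degree, completes the right side to a power of \<open>p * (p + 2)\<close>.\<close>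
  then have "((p + 1) ^ 2) ^ (p + 1) * p ^ 2 \<le> (p * (p + 2)) ^ p * (p + 2) ^ 2 * p ^ 2"
    by (rule mult_right_mono) simp
  also have "\<dots> = (p * (p + 2)) ^ (p + 2)"
    by (simp only: power_add power_mult_distrib ac_simps)
  finally have "(((p + 1) ^ 2) ^ (p + 1) * p ^ 2) ^ p \<le> ((p * (p + 2)) ^ (p + 2)) ^ p"
    by (rule power_mono) simp
  moreover have "deg_prod_minus (\<lambda>d. d ^ d) (p + 1) (p + 1) = (((p + 1) ^ 2) ^ (p + 1) * p ^ 2) ^ p"
    unfolding deg_prod_minus_def
    by (simp only: add_diff_cancel_right' power2_eq_square power_mult_distrib flip: power_mult)
       (simp only: ac_simps)
  moreover have "deg_prod_complete (\<lambda>d. d ^ d) p (p + 2) = ((p * (p + 2)) ^ (p + 2)) ^ p"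
    unfolding deg_prod_complete_self_power by (simp only: ac_simps flip: power_mult)
  ultimately show ?thesis by simp
qed

lemma unbalanced_le_even:
  assumes "a < p + 1" "a + b = (p + 1) + (p + 1)"
  shows "deg_prod_complete (\<lambda>d. d ^ d) a b \<le> deg_prod_complete (\<lambda>d. d ^ d) p (p + 2)"
proof -
  have "a * b \<le> p * (p + 2)"
    using mult_le_of_sum_eq[of a "p + 1" "p + 1" b] assms by simp
  then show ?thesis
    unfolding deg_prod_complete_self_power by (rule self_power_mono)
qed
subsection \<open>Second-largest values\<close>

text \<open>Common to both indices: for each \<open>g\<close> only the comparison with unbalanced
  graphs is left open. The bound \<open>2 \<le> s\<close> keeps \<open>K_{s,t} - e\<close>
  connected.\<close>

lemma minus_edge_second_largest:
  assumes G: "complete_bipartite_minus_edge s t G" and "mono g" "s \<le> t" "t \<le> s + 1" "2 \<le> s"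
    and "g (s - 1) < g s" "g (t - 1) < g t"
    and unbalanced: "\<And>a b. a < s \<Longrightarrow> a + b = s + t \<Longrightarrow> deg_prod_complete g a b \<le> deg_prod_minus g s t"
  shows "has_second_largest (deg_prod g) (connected_bipartite_graphs (s + t)) G"
proof -
  obtain U V u v where UV: "finite U" "finite V" "U \<inter> V = {}" "card U = s" "card V = t"
    "u \<in> U" "v \<in> V" and G_eq: "G = delete_edge (bipartite_join U V) u v"
    using G by (rule complete_bipartite_minus_edgeE)
  have "deg_prod g G = deg_prod_minus g s t"
    using UV by (simp add: G_eq deg_prod_delete_edge)
  moreover have "G \<in> connected_bipartite_graphs (s + t)"
    using delete_edge_in_class[of U V u v] UV assms by (simp add: G_eq)
  ultimately show ?thesis
    using assms by (intro has_second_largest_deg_prod) (simp_all add: deg_prod_minus_less_complete)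
qed

text \<open>The degree-product form of the second index is available for pair graphs, so it is
  substituted on members of the class, the only places where the index is evaluated.\<close>

lemma has_second_largest_zagreb2_iff:
  "has_second_largest zagreb2 (connected_bipartite_graphs n) G \<longleftrightarrow>
     has_second_largest (deg_prod (\<lambda>d. d ^ d)) (connected_bipartite_graphs n) G"
proof -
  have "zagreb2 H = deg_prod (\<lambda>d. d ^ d) H" if "H \<in> connected_bipartite_graphs n"
    for H :: "'a pair_pre_digraph"
    using that by (simp add: connected_bipartite_graphs_def zagreb2_eq_deg_prod)
  then show ?thesis
    by (simp add: has_second_largest_def cong: conj_cong)
qed

lemma mono_square: "mono (\<lambda>d :: nat. d ^ 2)"
  by (intro monoI power_mono) auto

lemma mono_self_power: "mono (\<lambda>d :: nat. d ^ d)"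
  by (intro monoI self_power_mono)

lemma minus_edge_second_largest_zagreb1:
  assumes "complete_bipartite_minus_edge s t G" "s \<le> t" "t \<le> s + 1" "2 \<le> s"
  shows "has_second_largest zagreb1 (connected_bipartite_graphs (s + t)) G"
  unfolding zagreb1_eq_deg_prod
proof (rule minus_edge_second_largest[OF assms(1) mono_square assms(2-4)])
  show "(s - 1) ^ 2 < s ^ 2" "(t - 1) ^ 2 < t ^ 2"
    using assms by (auto intro!: power_strict_mono)
  show "deg_prod_complete (\<lambda>d. d ^ 2) a b \<le> deg_prod_minus (\<lambda>d. d ^ 2) s t"
    if "a < s" "a + b = s + t" for a b
    unfolding deg_prod_complete_square deg_prod_minus_square
    using deg_prod_complete_id_le[OF that(1) assms(2) that(2)] by (rule power_mono) simp
qed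

lemma minus_edge_second_largest_zagreb2:
  assumes "complete_bipartite_minus_edge s (s + 1) G" "2 \<le> s"
  shows "has_second_largest zagreb2 (connected_bipartite_graphs (s + (s + 1))) G"
  unfolding has_second_largest_zagreb2_iff
proof (rule minus_edge_second_largest[OF assms(1) mono_self_power])
  show "(s - 1) ^ (s - 1) < s ^ s" "(s + 1 - 1) ^ (s + 1 - 1) < (s + 1) ^ (s + 1)"
    using assms by (auto intro!: self_power_strict_mono simp del: power_Suc)
qed (use assms unbalanced_le_minus_odd in auto)

lemma unbalanced_second_largest_zagreb2:
  assumes "complete_bipartite_digraph p (p + 2) (with_proj G)" "1 \<le> p"
  shows "has_second_largest zagreb2 (connected_bipartite_graphs ((p + 1) + (p + 1))) G"
  unfolding has_second_largest_zagreb2_iff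
proof (rule has_second_largest_deg_prod[OF mono_self_power])
  obtain U V where UV: "finite U" "finite V" "U \<inter> V = {}" "card U = p" "card V = p + 2"
    and G: "G = bipartite_join U V"
    using assms(1) unfolding complete_bipartite_digraph_iff by blast
  have eq: "deg_prod (\<lambda>d. d ^ d) G = deg_prod_complete (\<lambda>d. d ^ d) p (p + 2)"
    using UV by (simp add: G deg_prod_bipartite_join)
  have "U \<noteq> {}" "V \<noteq> {}" using UV assms(2) by auto
  then show "G \<in> connected_bipartite_graphs ((p + 1) + (p + 1))"
    using bipartite_join_in_class[OF UV(1-3)] UV by (simp add: G)
  have "p * (p + 2) < (p + 1) * (p + 1)" "2 \<le> (p + 1) * (p + 1)" using assms(2) by auto
  then show "deg_prod (\<lambda>d. d ^ d) G < deg_prod_complete (\<lambda>d. d ^ d) (p + 1) (p + 1)"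
    unfolding eq deg_prod_complete_self_power by (rule self_power_strict_mono)
  show "deg_prod_minus (\<lambda>d. d ^ d) (p + 1) (p + 1) \<le> deg_prod (\<lambda>d. d ^ d) G"
    unfolding eq by (rule minus_le_unbalanced_even)
  show "deg_prod_complete (\<lambda>d. d ^ d) a b \<le> deg_prod (\<lambda>d. d ^ d) G"
    if "a < p + 1" "a + b = (p + 1) + (p + 1)" for a b
    unfolding eq using that by (rule unbalanced_le_even)
qed simp_all

theorem theorem4p2:
  fixes n :: nat
  assumes "n > 2"
  shows
    "(odd n \<and> n \<noteq> 3 \<longrightarrow>
        (\<forall>G :: 'a pair_pre_digraph.
           complete_bipartite_minus_edge (nat \<lfloor>real n / 2\<rfloor>) (nat \<lceil>real n / 2\<rceil>) G \<longrightarrow>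
             has_second_largest zagreb1 (connected_bipartite_graphs n) G \<and>
             has_second_largest zagreb2 (connected_bipartite_graphs n) G)) \<and>
     (even n \<longrightarrow>
        (\<forall>G :: 'a pair_pre_digraph.
           complete_bipartite_minus_edge (nat \<lfloor>real n / 2\<rfloor>) (nat \<lceil>real n / 2\<rceil>) G \<longrightarrow>
             has_second_largest zagreb1 (connected_bipartite_graphs n) G) \<and>
        (\<forall>G :: 'a pair_pre_digraph.
           complete_bipartite_digraph (nat \<lfloor>(real n - 2) / 2\<rfloor>) (nat \<lceil>(real n + 2) / 2\<rceil>) (with_proj G) \<longrightarrow>
             has_second_largest zagreb2 (connected_bipartite_graphs n) G))"
proof (cases "even n")
  case True
  then obtain k where "n = 2 * k"
    by (rule evenE)
  \<comment> \<open>The shift \<open>p = k - 1\<close> turns the part sizes into \<open>p\<close>,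
    \<open>p + 1\<close> and \<open>p + 2\<close>, free of subtraction; \<open>n > 2\<close> gives
    \<open>p \<ge> 1\<close>.\<close>
  then have "n = (k - 1 + 1) + (k - 1 + 1)" "1 \<le> k - 1"
    using assms by simp_all
  then obtain p where n: "n = (p + 1) + (p + 1)" and "1 \<le> p"
    by blast
  have "real n / 2 = real (p + 1)" "(real n - 2) / 2 = real p" "(real n + 2) / 2 = real (p + 2)"
    by (simp_all add: n)
  then have "nat \<lfloor>real n / 2\<rfloor> = p + 1" "nat \<lceil>real n / 2\<rceil> = p + 1"
    "nat \<lfloor>(real n - 2) / 2\<rfloor> = p" "nat \<lceil>(real n + 2) / 2\<rceil> = p + 2"
    by (simp_all only: floor_of_nat ceiling_of_nat nat_int)
  with \<open>1 \<le> p\<close> show ?thesis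
    using minus_edge_second_largest_zagreb1[of "p + 1" "p + 1"] unbalanced_second_largest_zagreb2[of p] n
    by auto
next
  case False
  then obtain s where n: "n = s + (s + 1)"
    by (metis add.assoc mult_2 oddE)
  have "\<lfloor>real n / 2\<rfloor> = int s" "\<lceil>real n / 2\<rceil> = int (s + 1)"
    by (simp_all add: n floor_eq_iff ceiling_eq_iff)
  then have "nat \<lfloor>real n / 2\<rfloor> = s" "nat \<lceil>real n / 2\<rceil> = s + 1"
    by (simp_all only: nat_int)
  \<comment> \<open>Order 3 is the case \<open>s = 1\<close>, where deleting an edge isolates a
    vertex.\<close>
  moreover have "2 \<le> s" if "n \<noteq> 3"
    using that assms n by simp
  ultimately show ?thesis
    using minus_edge_second_largest_zagreb1[of s "s + 1"] minus_edge_second_largest_zagreb2[of s] False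
    by (auto simp: n)
qed

end
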